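(* Let $q\ge 4$ be a power of $2$ and let $n=1+q^{a_1}+q^{b_1}+\cdots+q^{a_{q/2}}+q^{b_{q/2}}$, where $a_i,b_i\ge 0$ are integers. Then, as polynomials, $g_{n,q}=\sum_{i=1}^{q/2}S_{a_i}S_{b_i}+\sum_{1\le i<j\le q/2}(S_{a_i}+S_{b_i})(S_{a_j}+S_{b_j})$.
   Context: For a prime $p$, a power $q$ of $p$ and an integer $n\ge 0$, $g_{n,q}\in\mathbb{F}_p[x]$ is the unique polynomial with $\sum_{a\in\mathbb{F}_q}(x+a)^n=g_{n,q}(x^q-x)$. For an integer $a\ge 0$, $S_a=x+x^q+\cdots+x^{q^{a-1}}\in\mathbb{F}_p[x]$ (so $S_0=0$). *)

theory Defs
  imports "HOL-Algebra.Algebraic_Closure_Type" "HOL-Library.Cardinality"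
begin

(* 'f plays the role of the prime field F_p.  For a power q of p, the field F_q is the
   subfield of the algebraic closure of F_p formed by the roots of x^q - x. *)
definition Fq :: "nat \<Rightarrow> 'f::field alg_closure set" where
  "Fq q = {a. a ^ q = a}"

(* The sum of the (x + a)^n lives in F_q[x], so g is lifted along the embedding to_ac
   of F_p into its algebraic closure.  [:a, 1:] is the polynomial x + a. *)
definition g_poly :: "nat \<Rightarrow> nat \<Rightarrow> 'f::field poly" where
  "g_poly n q = (THE g. (\<Sum>a\<in>Fq q. [:a, 1:] ^ n) =
     pcompose (map_poly to_ac g) (monom 1 q - monom 1 1))"

definition S_poly :: "nat \<Rightarrow> nat \<Rightarrow> 'f::field poly" where
  "S_poly q a = (\<Sum>i<a. monom 1 (q ^ i))"

end

theory Submission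
  imports Defs "HOL-Number_Theory.Residues"
begin

text \<open>For \<open>c\<close> in the field with \<open>q\<close> elements and \<open>y = x\<^sup>q - x\<close>, the power of \<open>x + c\<close> with exponent
  \<open>q\<^sup>a\<close> equals \<open>(x + c) + S\<^sub>a(y)\<close>. Hence \<open>(x + c)\<^sup>n\<close> is the value at \<open>t = x + c\<close> of a polynomial in \<open>t\<close> of
  degree \<open>q + 1\<close>, namely \<open>t\<close> times a product of \<open>q\<close> linear factors whose coefficients are polynomials
  in \<open>y\<close> not depending on \<open>c\<close>. Among the exponents \<open>k \<le> q + 1\<close>, the sum of \<open>(x + c)\<^sup>k\<close> over all
  \<open>c\<close> is nonzero only for \<open>k = q - 1\<close>, where it is \<open>-1 = 1\<close>. So the sum is the second elementary
  symmetric polynomial of the \<open>S\<^sub>a(y)\<close>, which the pairing of the exponents splits as claimed.\<close>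

section \<open>Finite fields inside an algebraic closure\<close>

text \<open>Over an algebraically closed field \<open>p\<close> splits into linear factors. A factor
  occurring twice would make the derivative vanish at its root, so the multiset of roots is a
  set.\<close>

lemma card_roots_eq_degree:
  fixes p :: "'a::alg_closed_field poly"
  assumes p: "p \<noteq> 0" and sep: "\<And>x. poly p x = 0 \<Longrightarrow> poly (pderiv p) x \<noteq> 0"
  shows "card {x. poly p x = 0} = degree p"
proof -
  obtain A where A: "size A = degree p" "p = smult (lead_coeff p) (\<Prod>x\<in>#A. [:-x, 1:])"
    using alg_closed_imp_factorization[OF p] by blast
  have roots: "poly p x = 0 \<longleftrightarrow> x \<in># A" for x
    using p by (subst A(2)) (auto simp: poly_prod_mset prod_mset_zero_iff)
  have simple: "count A x = 1" if x: "x \<in># A" for x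
  proof (rule ccontr)
    assume "count A x \<noteq> 1"
    then obtain B where B: "A = add_mset x (add_mset x B)"
      using x by (metis count_add_mset count_inI insert_DiffM One_nat_def)
    have "p = [:-x, 1:] * ([:-x, 1:] * smult (lead_coeff p) (\<Prod>x\<in>#B. [:-x, 1:]))"
      by (subst A(2), subst B) (simp add: mult_ac)
    then obtain r where "p = [:-x, 1:] * ([:-x, 1:] * r)" by blast
    then have "poly (pderiv p) x = 0" by (simp only: pderiv_mult poly_add poly_mult) simp
    with sep roots x show False by blast
  qed
  have "card (set_mset A) = size A"
    by (simp add: size_multiset_overloaded_eq simple)
  moreover have "set_mset A = {x. poly p x = 0}" using roots by blast
  ultimately show ?thesis using A(1) by simp
qed

context
  fixes q e :: nat
  assumes char_prime: "prime CHAR('f::field)" and q_eq: "q = CHAR('f) ^ e" and q_gt: "q > 3"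
begin

lemma exponent_pos: "e > 0"
  using q_gt q_eq by (cases e) auto

lemma of_nat_q_eq_0: "of_nat q = (0 :: 'f alg_closure)"
  using exponent_pos by (simp add: of_nat_eq_0_iff_char_dvd q_eq)

lemma of_nat_q_minus_1: "of_nat (q - 1) = (-1 :: 'f alg_closure)"
  using of_nat_q_eq_0 q_gt by (simp add: of_nat_diff)

lemma Fq_eq_roots: "(Fq q :: 'f alg_closure set) = {x. poly (monom 1 q - monom 1 1) x = 0}"
  by (simp add: Fq_def poly_monom)

lemma degree_monom_q_diff: "degree (monom 1 q - monom 1 1 :: 'f alg_closure poly) = q"
proof -
  have "degree (- monom 1 1 + monom 1 q :: 'f alg_closure poly) = degree (monom 1 q :: 'f alg_closure poly)"
    using q_gt by (intro degree_add_eq_right) (simp add: degree_monom_eq)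
  then show ?thesis by (simp add: degree_monom_eq)
qed

lemma monom_q_diff_nonzero: "(monom 1 q - monom 1 1 :: 'f alg_closure poly) \<noteq> 0"
  using degree_monom_q_diff q_gt by (metis degree_0 not_less0)

text \<open>The derivative of \<open>x^q - x\<close> is the constant -1, because \<open>q\<close> is
  0 in the field; hence all roots are simple.\<close>

lemma card_Fq: "card (Fq q :: 'f alg_closure set) = q"
proof -
  have "pderiv (monom 1 q - monom 1 1) = (-1 :: 'f alg_closure poly)"
    by (simp add: pderiv_diff pderiv_monom of_nat_q_eq_0)
  then show ?thesis unfolding Fq_eq_roots
    by (subst card_roots_eq_degree) (simp_all add: monom_q_diff_nonzero degree_monom_q_diff del: One_nat_def right_minus_eq)
qed

lemma finite_Fq: "finite (Fq q :: 'f alg_closure set)"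
  using card_Fq q_gt by (intro card_ge_0_finite) simp

lemma Fq_power_q_minus_1:
  fixes c :: "'f alg_closure"
  assumes "c \<in> Fq q" "c \<noteq> 0"
  shows "c ^ (q - 1) = 1"
proof -
  have "c * c ^ (q - 1) = c"
    using assms q_gt by (simp add: Fq_def flip: power_Suc)
  then show ?thesis using assms(2) by simp
qed

text \<open>For \<open>0 < j < q - 1\<close> some nonzero \<open>d\<close> in the field has \<open>d\<^sup>j \<noteq> 1\<close>, and the substitution
  \<open>c \<mapsto> d c\<close> multiplies the sum by \<open>d\<^sup>j\<close>.\<close>

lemma sum_powers_Fq_eq_0:
  assumes j: "j < q - 1"
  shows "(\<Sum>c\<in>Fq q. c ^ j) = (0 :: 'f alg_closure)"
proof (cases "j = 0")
  case True
  then show ?thesis by (simp add: card_Fq of_nat_q_eq_0)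
next
  case False
  have "\<exists>d \<in> Fq q - {0}. d ^ j \<noteq> (1 :: 'f alg_closure)"
  proof (rule ccontr)
    assume "\<not> ?thesis"
    then have sub: "Fq q - {0} \<subseteq> {x :: 'f alg_closure. poly (monom 1 j - 1) x = 0}"
      by (auto simp: poly_monom)
    have deg: "degree (monom 1 j - 1 :: 'f alg_closure poly) = j"
    proof -
      have "degree (- 1 + monom 1 j :: 'f alg_closure poly) = degree (monom 1 j :: 'f alg_closure poly)"
        using False by (intro degree_add_eq_right) (simp add: degree_monom_eq)
      then show ?thesis by (simp add: degree_monom_eq)
    qed
    then have nz: "(monom 1 j - 1 :: 'f alg_closure poly) \<noteq> 0"
      using False by auto
    have "(0 :: 'f alg_closure) \<in> Fq q" using q_gt by (simp add: Fq_def)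
    then have "q - 1 = card (Fq q - {0 :: 'f alg_closure})"
      using finite_Fq by (simp add: card_Fq)
    also have "\<dots> \<le> j"
      using card_mono[OF poly_roots_finite[OF nz] sub] card_poly_roots_bound[OF nz] deg by simp
    finally show False using j by simp
  qed
  then obtain d :: "'f alg_closure" where d: "d \<in> Fq q" "d \<noteq> 0" "d ^ j \<noteq> 1" by blast
  have "(\<Sum>c\<in>Fq q. c ^ j) = (\<Sum>c\<in>Fq q. (d * c) ^ j)"
    using d by (intro sum.reindex_bij_witness[of _ "\<lambda>c. d * c" "\<lambda>c. c / d"])
      (auto simp: Fq_def power_mult_distrib power_divide)
  also have "\<dots> = d ^ j * (\<Sum>c\<in>Fq q. c ^ j)"
    by (simp add: power_mult_distrib sum_distrib_left)
  finally show ?thesis using d(3) by auto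
qed

text \<open>Each of the \<open>q - 1\<close> nonzero elements contributes 1, and
  \<open>q - 1\<close> is -1 in the field.\<close>

lemma sum_powers_Fq_q_minus_1: "(\<Sum>c\<in>Fq q. c ^ (q - 1)) = (-1 :: 'f alg_closure)"
proof -
  have 0: "(0 :: 'f alg_closure) \<in> Fq q" using q_gt by (simp add: Fq_def)
  have "(\<Sum>c\<in>Fq q. c ^ (q - 1)) = (\<Sum>c\<in>Fq q - {0}. c ^ (q - 1) :: 'f alg_closure)"
    using q_gt finite_Fq by (intro sum.mono_neutral_right) (auto simp: power_0_left)
  also have "\<dots> = of_nat (card (Fq q - {0 :: 'f alg_closure}))"
    by (simp add: Fq_power_q_minus_1 del: One_nat_def)
  also have "card (Fq q - {0 :: 'f alg_closure}) = q - 1"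
    using finite_Fq 0 by (simp add: card_Fq)
  finally show ?thesis by (simp only: of_nat_q_minus_1)
qed

section \<open>Sums of powers of the linear polynomials \<open>x + c\<close>\<close>

lemma linear_eq_monom_add: "[:c, 1:] = monom 1 1 + [:c :: 'f alg_closure:]"
  by (simp add: monom_altdef)

lemma sum_const_poly: "(\<Sum>c\<in>A. [:f c:]) = [:\<Sum>c\<in>A. f c:]"
  for f :: "'b \<Rightarrow> 'f alg_closure"
  by (induction A rule: infinite_finite_induct) auto

lemma Fq_power_iterate: "c ^ (q ^ a) = c" if "c \<in> Fq q" for c :: "'f alg_closure"
  using that by (induction a) (simp_all add: Fq_def power_mult)

lemma power_q_power_add: "(x + y) ^ (q ^ a) = x ^ (q ^ a) + y ^ (q ^ a)"
  for x y :: "'f alg_closure poly"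
  by (rule freshmans_dream'[where n = "e * a"]) (simp_all add: char_prime q_eq power_mult)

lemma power_q_power_diff: "(x - y) ^ (q ^ a) = x ^ (q ^ a) - y ^ (q ^ a)"
  for x y :: "'f alg_closure poly"
  using power_q_power_add[of "x - y" y a] by simp

lemma linear_power_q_power:
  fixes c :: "'f alg_closure"
  assumes "c \<in> Fq q"
  shows "[:c, 1:] ^ (q ^ a) = monom 1 (q ^ a) + [:c:]"
  unfolding linear_eq_monom_add power_q_power_add
  by (simp add: monom_power poly_const_pow Fq_power_iterate[OF assms])

text \<open>In the binomial expansion \<open>x^(k - j)\<close> carries the sum of the
  \<open>c ^ j\<close>, which vanishes for \<open>j < q - 1\<close>; only \<open>j = k\<close> can
  survive.\<close>

lemma sum_linear_powers:
  assumes k: "k \<le> q - 1"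
  shows "(\<Sum>c\<in>Fq q. [:c, 1:] ^ k) = (if k = q - 1 then -1 else 0 :: 'f alg_closure poly)"
proof -
  have "(\<Sum>c\<in>Fq q. [:c, 1:] ^ k) =
      (\<Sum>j\<le>k. of_nat (k choose j) * [:\<Sum>c\<in>Fq q. c ^ j :: 'f alg_closure:] * monom 1 (k - j))"
    unfolding linear_eq_monom_add
    by (subst add.commute, subst binomial_ring, subst sum.swap)
      (simp add: sum_distrib_left sum_distrib_right poly_const_pow monom_power flip: sum_const_poly)
  also have "\<dots> = (\<Sum>j\<in>{k}. of_nat (k choose j) * [:\<Sum>c\<in>Fq q. c ^ j:] * monom 1 (k - j))"
    using k by (intro sum.mono_neutral_right) (auto simp: sum_powers_Fq_eq_0)
  also have "\<dots> = [:\<Sum>c\<in>Fq q. c ^ k:]" by simp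
  also have "\<dots> = (if k = q - 1 then -1 else 0)"
    using k sum_powers_Fq_eq_0[of k] sum_powers_Fq_q_minus_1
    by (auto simp: one_pCons)
  finally show ?thesis .
qed

text \<open>A binomial expansion would now meet the nonzero power sum of order \<open>q - 1\<close>;
  Frobenius avoids it through \<open>(x + c)^q = x^q + c\<close>.\<close>

lemma sum_linear_power_q: "(\<Sum>c\<in>Fq q. [:c, 1:] ^ q) = (0 :: 'f alg_closure poly)"
proof -
  have "(\<Sum>c\<in>Fq q. [:c, 1:] ^ q) = (\<Sum>c\<in>Fq q. monom 1 q + [:c :: 'f alg_closure:])"
    using linear_power_q_power[where a = 1] by (intro sum.cong) simp_all
  also have "\<dots> = of_nat q * monom 1 q + [:\<Sum>c\<in>Fq q. c ^ 1:]"
    by (simp add: sum.distrib card_Fq sum_const_poly)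
  also have "(\<Sum>c\<in>Fq q. c ^ 1 :: 'f alg_closure) = 0"
    using q_gt by (intro sum_powers_Fq_eq_0) simp
  finally show ?thesis by (simp add: of_nat_poly of_nat_q_eq_0)
qed

lemma sum_linear_power_Suc_q: "(\<Sum>c\<in>Fq q. [:c, 1:] ^ Suc q) = (0 :: 'f alg_closure poly)"
proof -
  have "(\<Sum>c\<in>Fq q. [:c, 1:] ^ Suc q) =
      (\<Sum>c\<in>Fq q. (monom 1 1 + [:c:]) * (monom 1 q + [:c :: 'f alg_closure:]))"
    using linear_power_q_power[where a = 1] linear_eq_monom_add by (intro sum.cong) simp_all
  also have "\<dots> = (\<Sum>c\<in>Fq q. monom 1 (Suc q) + (monom 1 1 + monom 1 q) * [:c:] + [:c ^ 2:])"
    by (intro sum.cong) (simp_all add: algebra_simps power2_eq_square mult_monom)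
  also have "\<dots> = of_nat q * monom 1 (Suc q) + (monom 1 1 + monom 1 q) * [:\<Sum>c\<in>Fq q. c ^ 1:]
      + [:\<Sum>c\<in>Fq q. c ^ 2:]"
    by (simp add: sum.distrib card_Fq flip: sum_const_poly sum_distrib_left del: mult_pCons_right)
  also have "(\<Sum>c\<in>Fq q. c ^ 1 :: 'f alg_closure) = 0"
    using q_gt by (intro sum_powers_Fq_eq_0) simp
  \<comment> \<open>This needs \<open>2 < q - 1\<close>, which is exactly
    \<open>q > 3\<close>.\<close>
  also have "(\<Sum>c\<in>Fq q. c ^ 2 :: 'f alg_closure) = 0"
    using q_gt by (intro sum_powers_Fq_eq_0) simp
  finally show ?thesis by (simp add: of_nat_poly of_nat_q_eq_0)
qed

text \<open>The coefficients of \<open>P\<close> are polynomials in \<open>x\<close> independent of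
  \<open>c\<close>, so the sum over \<open>c\<close> meets only powers of
  \<open>x + c\<close>.\<close>

lemma sum_poly_linear:
  fixes P :: "'f alg_closure poly poly"
  assumes P: "degree P \<le> q + 1"
  shows "(\<Sum>c\<in>Fq q. poly P [:c, 1:]) = - coeff P (q - 1)"
proof -
  have "(\<Sum>c\<in>Fq q. poly P [:c, 1:]) = (\<Sum>c\<in>Fq q. \<Sum>i\<le>q + 1. coeff P i * [:c, 1:] ^ i)"
    by (subst poly_as_sum_of_monoms'[OF P, symmetric]) (simp add: poly_sum poly_monom)
  also have "\<dots> = (\<Sum>i\<le>q + 1. coeff P i * (\<Sum>c\<in>Fq q. [:c, 1:] ^ i))"
    by (subst sum.swap) (simp add: sum_distrib_left)
  also have "\<dots> = (\<Sum>i\<in>{q - 1}. coeff P i * (\<Sum>c\<in>Fq q. [:c, 1:] ^ i))"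
  proof (intro sum.mono_neutral_right ballI)
    fix i assume "i \<in> {..q + 1} - {q - 1}"
    then consider "i < q - 1" | "i = q" | "i = Suc q" by fastforce
    then show "coeff P i * (\<Sum>c\<in>Fq q. [:c, 1:] ^ i) = 0"
      by cases (simp_all add: sum_linear_powers sum_linear_power_q sum_linear_power_Suc_q
          del: power_Suc)
  qed auto
  also have "\<dots> = - coeff P (q - 1)" by (simp add: sum_linear_powers)
  finally show ?thesis .
qed

section \<open>Substituting \<open>x\<^sup>q - x\<close>\<close>

text \<open>The right-hand side of the identity defining \<open>g_poly\<close>, named so that it can
  be treated as an injective ring homomorphism in \<open>g\<close>.\<close>

definition Fq_lift :: "'f poly \<Rightarrow> 'f alg_closure poly" where
  "Fq_lift g = pcompose (map_poly to_ac g) (monom 1 q - monom 1 1)"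

lemma pcompose_monom: "pcompose (monom 1 n) p = p ^ n"
  for p :: "'b::comm_semiring_1 poly"
  by (induction n) (simp_all add: monom_0 monom_Suc pcompose_pCons)

lemma Fq_lift_add: "Fq_lift (g + h) = Fq_lift g + Fq_lift h"
proof -
  have "map_poly to_ac (g + h) = map_poly to_ac g + map_poly to_ac h"
    by (intro poly_eqI) (simp add: coeff_map_poly)
  then show ?thesis by (simp add: Fq_lift_def pcompose_add)
qed

lemma Fq_lift_mult: "Fq_lift (g * h) = Fq_lift g * Fq_lift h"
proof -
  have "map_poly to_ac (g * h) = map_poly to_ac g * map_poly to_ac h"
    by (intro poly_eqI) (simp add: coeff_map_poly coeff_mult to_ac_sum)
  then show ?thesis by (simp add: Fq_lift_def pcompose_mult)
qed

lemma Fq_lift_sum: "Fq_lift (\<Sum>i\<in>A. f i) = (\<Sum>i\<in>A. Fq_lift (f i))"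
  by (induction A rule: infinite_finite_induct)
    (simp_all add: Fq_lift_add, simp_all add: Fq_lift_def)

text \<open>Over a field, substituting a nonconstant polynomial into a nonzero one cannot give
  zero.\<close>

lemma inj_Fq_lift: "inj Fq_lift"
proof
  fix g h assume "Fq_lift g = Fq_lift h"
  then have "Fq_lift (g - h) = 0"
    using Fq_lift_add[of "g - h" h] by simp
  then have "map_poly to_ac (g - h) = 0"
    using q_gt by (simp add: Fq_lift_def pcompose_eq_0_iff degree_monom_q_diff del: One_nat_def)
  then show "g = h" by (simp add: map_poly_eq_0_iff)
qed

text \<open>By Frobenius the term \<open>x^(q^i)\<close> becomes
  \<open>x^(q^(i+1)) - x^(q^i)\<close>, and the sum telescopes.\<close>

lemma Fq_lift_S_poly: "Fq_lift (S_poly q a) = monom 1 (q ^ a) - monom 1 1"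
proof (induction a)
  case 0
  then show ?case by (simp add: S_poly_def Fq_lift_def)
next
  case (Suc a)
  have "Fq_lift (monom 1 (q ^ a)) = (monom 1 q - monom 1 1) ^ (q ^ a)"
    by (simp add: Fq_lift_def map_poly_monom pcompose_monom)
  also have "\<dots> = monom 1 (q ^ Suc a) - monom 1 (q ^ a)"
    by (simp add: power_q_power_diff monom_power)
  finally show ?case
    using Suc.IH by (simp add: S_poly_def Fq_lift_add)
qed

text \<open>Injectivity of \<open>Fq_lift\<close> supplies the uniqueness that \<open>THE\<close>
  demands.\<close>

lemma g_poly_eqI:
  assumes "(\<Sum>a\<in>Fq q. [:a, 1:] ^ n) = Fq_lift g"
  shows "g_poly n q = g"
  unfolding g_poly_def assms Fq_lift_def[symmetric]
  by (rule the_equality) (auto dest: injD[OF inj_Fq_lift])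

end

section \<open>Top coefficients of a product of monic quadratics\<close>

lemma sum_pairs_Suc:
  fixes f :: "nat \<Rightarrow> nat \<Rightarrow> 'a::comm_monoid_add"
  shows "(\<Sum>(i, j)\<in>{(i, j). 1 \<le> i \<and> i < j \<and> j \<le> Suc h}. f i j) =
    (\<Sum>(i, j)\<in>{(i, j). 1 \<le> i \<and> i < j \<and> j \<le> h}. f i j) + (\<Sum>i=1..h. f i (Suc h))"
proof -
  have split: "{(i, j). 1 \<le> i \<and> i < j \<and> j \<le> Suc h} =
      {(i, j). 1 \<le> i \<and> i < j \<and> j \<le> h} \<union> (\<lambda>i. (i, Suc h)) ` {1..h}"
    by (auto simp: le_Suc_eq)
  have fin: "finite {(i, j). 1 \<le> i \<and> i < j \<and> j \<le> h}"
    by (rule finite_subset[of _ "{..h} \<times> {..h}"]) auto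
  show ?thesis unfolding split
    by (subst sum.union_disjoint[OF fin]) (auto simp: sum.reindex inj_on_def)
qed

lemma coeff_mult_monic_quadratic:
  "coeff (p * [:v, u, 1:]) (Suc (Suc n)) =
     coeff p (Suc (Suc n)) * v + coeff p (Suc n) * u + coeff p n"
  for p :: "'a::comm_semiring_1 poly"
  by (simp add: mult.commute[of p] algebra_simps)

text \<open>The exponent drops by 2 from the top if one factor gives its constant term
  \<open>v i\<close>, or if two factors give their linear terms. The guard \<open>h > 0\<close>
  keeps the truncated subtractions exact.\<close>

lemma top_coeffs_prod_monic_quadratics:
  fixes u v :: "nat \<Rightarrow> 'a::comm_semiring_1"
  defines "P \<equiv> \<lambda>h. \<Prod>i=1..h. [:v i, u i, 1:]"
  shows "degree (P h) \<le> 2 * h" "coeff (P h) (2 * h) = 1"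
    "h > 0 \<Longrightarrow> coeff (P h) (2 * h - 1) = (\<Sum>i=1..h. u i)"
    "h > 0 \<Longrightarrow> coeff (P h) (2 * h - 2) =
      (\<Sum>i=1..h. v i) + (\<Sum>(i, j)\<in>{(i, j). 1 \<le> i \<and> i < j \<and> j \<le> h}. u i * u j)"
proof (induction h)
  case (Suc h)
  have P: "P (Suc h) = P h * [:v (Suc h), u (Suc h), 1:]" by (simp add: P_def mult.commute)
  have high: "coeff (P h) m = 0" if "m > 2 * h" for m
    using Suc.IH(1) that by (intro coeff_eq_0) simp
  { case 1
    have "degree (P (Suc h)) \<le> degree (P h) + degree [:v (Suc h), u (Suc h), 1:]"
      unfolding P by (rule degree_mult_le)
    then show ?case using Suc.IH(1) by simp
  next
    case 2
    show ?case unfolding P mult_Suc_right add_2_eq_Suc coeff_mult_monic_quadratic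
      by (simp add: high Suc.IH(2))
  next
    case 3
    show ?case
    proof (cases h)
      case 0
      then show ?thesis by (simp add: P_def)
    next
      case (Suc k)
      \<comment> \<open>The first rewriting fails for \<open>h = 0\<close>, since subtraction
        truncates; hence the case split.\<close>
      then have *: "2 * Suc h - 1 = Suc (Suc (2 * h - 1))" "Suc (2 * h - 1) = 2 * h" by simp_all
      show ?thesis unfolding P *(1) coeff_mult_monic_quadratic
        unfolding *(2) using \<open>h = Suc k\<close> Suc.IH high[of "Suc (2 * h)"]
        by (simp add: add_ac)
    qed
  next
    case 4
    show ?case
    proof (cases h)
      case 0
      have empty: "{(i, j). Suc 0 \<le> i \<and> i < j \<and> j \<le> Suc 0} = {}" by auto
      show ?thesis unfolding 0 by (simp add: P_def empty)
    next
      case (Suc k)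
      then have *: "2 * Suc h - 2 = Suc (Suc (2 * h - 2))" "Suc (2 * h - 2) = 2 * h - 1"
        "Suc (2 * h - 1) = 2 * h" by simp_all
      show ?thesis unfolding P *(1) coeff_mult_monic_quadratic
        unfolding *(2,3) sum_pairs_Suc using Suc Suc.IH
        by (simp add: add_ac distrib_right sum_distrib_right)
    qed
  }
qed (simp_all add: P_def)

theorem theorem6p1:
  fixes q e n :: nat and a b :: "nat \<Rightarrow> nat"
  assumes F2: "CARD('f) = 2"
    and q: "q = 2 ^ e" "q \<ge> 4"
    and n: "n = 1 + (\<Sum>i=1..q div 2. q ^ a i + q ^ b i)"
  shows "(g_poly n q :: 'f::field poly) =
    (\<Sum>i=1..q div 2. S_poly q (a i) * S_poly q (b i)) +
    (\<Sum>(i, j)\<in>{(i, j). 1 \<le> i \<and> i < j \<and> j \<le> q div 2}.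
       (S_poly q (a i) + S_poly q (b i)) * (S_poly q (a j) + S_poly q (b j)))"
    (is "_ = ?g")
proof -
  have "CHAR('f) dvd 2" using CHAR_dvd_CARD[where 'a = 'f] F2 by simp
  then have char: "CHAR('f) = 2"
    using CHAR_not_1[where 'a = 'f] two_is_prime_nat by (auto simp: prime_nat_iff)
  then have hyps: "prime CHAR('f)" "q = CHAR('f) ^ e" "q > 3" using q by simp_all
  note lift_simps = Fq_lift_add[OF hyps] Fq_lift_mult[OF hyps] Fq_lift_sum[OF hyps]
  define h where "h = q div 2"
  have "even q" using q by (cases e) auto
  then have h: "2 * h = q" "h > 0" using q(2) by (auto simp: h_def)
  let ?L = "Fq_lift q :: 'f poly \<Rightarrow> 'f alg_closure poly"
  define A where "A i = ?L (S_poly q (a i))" for i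
  define B where "B i = ?L (S_poly q (b i))" for i
  \<comment> \<open>Each factor is \<open>(t + A i) * (t + B i)\<close>, written as a quadratic in
    \<open>t\<close>.\<close>
  define P where "P = (\<Prod>i=1..h. [:A i * B i, A i + B i, 1:])"
  have shift: "[:c, 1:] ^ (q ^ k) = [:c, 1:] + ?L (S_poly q k)" if "c \<in> Fq q" for c k
    unfolding linear_power_q_power[OF hyps that] Fq_lift_S_poly[OF hyps]
    by (simp add: linear_eq_monom_add[OF hyps])
  \<comment> \<open>The summand 1 of \<open>n\<close> gives one more factor \<open>t\<close>,
    encoded by \<open>pCons 0\<close>; it shifts the relevant index from \<open>q - 1\<close> to
    \<open>2 * h - 2\<close>.\<close>
  have expand: "[:c, 1:] ^ n = poly (pCons 0 P) [:c, 1:]" if c: "c \<in> Fq q" for c :: "'f alg_closure"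
  proof -
    have "[:c, 1:] ^ n = [:c, 1:] * (\<Prod>i=1..h. [:c, 1:] ^ (q ^ a i) * [:c, 1:] ^ (q ^ b i))"
      by (simp add: n h_def power_add power_sum)
    also have "(\<Prod>i=1..h. [:c, 1:] ^ (q ^ a i) * [:c, 1:] ^ (q ^ b i)) = poly P [:c, 1:]"
      unfolding shift[OF c] P_def poly_prod A_def[symmetric] B_def[symmetric]
      by (intro prod.cong refl) (simp add: algebra_simps)
    finally show ?thesis by simp
  qed
  note top = top_coeffs_prod_monic_quadratics[where u = "\<lambda>i. A i + B i" and v = "\<lambda>i. A i * B i"
      and h = h, folded P_def]
  have "(\<Sum>c\<in>Fq q. [:c, 1:] ^ n) = - coeff (pCons 0 P) (q - 1)"
    using top(1) h(1) degree_pCons_le[of 0 P]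
    by (subst sum_poly_linear[OF hyps, symmetric]) (simp_all add: expand)
  also have "\<dots> = - coeff P (2 * h - 2)"
  proof -
    have "q - 1 = Suc (2 * h - 2)" using h q(2) by simp
    then show ?thesis by (simp only: coeff_pCons_Suc)
  qed
  \<comment> \<open>Characteristic 2 absorbs the sign.\<close>
  also have "\<dots> = coeff P (2 * h - 2)"
    using uminus_CHAR_2[where 'a = "'f alg_closure poly"] char by simp
  also have "\<dots> = ?L ?g"
    unfolding top(4)[OF h(2)] by (simp add: lift_simps A_def B_def h_def case_prod_unfold)
  finally show ?thesis by (rule g_poly_eqI[OF hyps])
qed

end
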